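(* Let $K$ be a field of characteristic zero and $\mathbb{A}_1$ the Jacobian algebra in one variable. Then: 1. ${}'\mathcal{C}_{\mathbb{A}_1}=\{\partial^{d(a)}a\mid a\in\mathbb{A}_1\setminus F\}$. 2. $\mathcal{C}'_{\mathbb{A}_1}=\theta({}'\mathcal{C}_{\mathbb{A}_1})$.
   Context: For a ring $R$, ${}'\mathcal{C}_R=\{c\in R\mid rc=0\Rightarrow r=0\}$ is the set of left regular elements and $\mathcal{C}'_R=\{c\in R\mid cr=0\Rightarrow r=0\}$ the set of right regular elements. $\mathbb{A}_1$ is the subalgebra of $\mathrm{End}_K(K[x])$ generated by multiplication by $x$, $\partial=\frac{d}{dx}$ and the inverse $H^{-1}$ of the bijective map $H:=\partial x$. Its unique proper nonzero ideal is $F=\bigoplus_{i,j\ge0}KE_{ij}$, where $E_{ij}(x^k)=\delta_{jk}x^i$. For $a\in\mathbb{A}_1\setminus F$, $d(a):=\min\{i\in\mathbb{N}\mid\partial^ia\in{}'\mathcal{C}_{\mathbb{A}_1}\}$, where $\mathbb{N}=\{0,1,2,\ldots\}$ (the set over which the minimum is taken is nonempty). $\theta$ is the involution of $\mathbb{A}_1$, i.e. the $K$-algebra anti-automorphism with $\theta(x)=\partial$, $\theta(\partial)=x$, $\theta(H^{-1})=H^{-1}$. *)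

theory Defs
  imports "HOL-Algebra.Generated_Rings" "HOL-Computational_Algebra.Polynomial"
begin

subsection \<open>Left and right regular elements of a ring\<close>

definition left_regular :: "('a, 'b) ring_scheme \<Rightarrow> 'a set" where
  "left_regular R =
     {c \<in> carrier R. \<forall>r\<in>carrier R. r \<otimes>\<^bsub>R\<^esub> c = \<zero>\<^bsub>R\<^esub> \<longrightarrow> r = \<zero>\<^bsub>R\<^esub>}"

definition right_regular :: "('a, 'b) ring_scheme \<Rightarrow> 'a set" where
  "right_regular R =
     {c \<in> carrier R. \<forall>r\<in>carrier R. c \<otimes>\<^bsub>R\<^esub> r = \<zero>\<^bsub>R\<^esub> \<longrightarrow> r = \<zero>\<^bsub>R\<^esub>}"

subsection \<open>The Jacobian algebra in one variable\<close>

text \<open>The field \<open>K\<close> is the type \<open>'k\<close> and \<open>K[x]\<close> is the type \<open>'k poly\<close>.\<close>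

type_synonym 'k poly_map = "'k poly \<Rightarrow> 'k poly"

definition End_poly :: "('k::field_char_0) poly_map ring" where
  "End_poly =
     \<lparr>carrier = {f. Vector_Spaces.linear smult smult f}, monoid.mult = (\<circ>), one = id,
      zero = (\<lambda>p. 0), add = (\<lambda>f g p. f p + g p)\<rparr>"

definition X_op :: "('k::field_char_0) poly_map" where
  "X_op p = [:0, 1:] * p"

definition D_op :: "('k::field_char_0) poly_map" where
  "D_op p = pderiv p"

definition H_op :: "('k::field_char_0) poly_map" where
  "H_op = D_op \<circ> X_op"

definition H_inv :: "('k::field_char_0) poly_map" where
  "H_inv = inv_into UNIV H_op"

text \<open>The unital \<open>K\<close>-subalgebra generated by a set is the subring generated by that set
  together with the scalar operators \<open>smult c\<close>.\<close>

definition jacobian_algebra :: "('k::field_char_0) poly_map ring" where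
  "jacobian_algebra =
     End_poly\<lparr>carrier := generate_ring End_poly (range smult \<union> {X_op, D_op, H_inv})\<rparr>"

definition E_op :: "nat \<Rightarrow> nat \<Rightarrow> ('k::field_char_0) poly_map" where
  "E_op i j p = monom (coeff p j) i"

definition F_ideal :: "('k::field_char_0) poly_map set" where
  "F_ideal =
     {\<lambda>p. \<Sum>(i, j)\<in>S. smult (c i j) (E_op i j p) | c S. finite S}"

definition d_index :: "('k::field_char_0) poly_map \<Rightarrow> nat" where
  "d_index a =
     (LEAST i. D_op [^]\<^bsub>jacobian_algebra\<^esub> i \<otimes>\<^bsub>jacobian_algebra\<^esub> a \<in> left_regular jacobian_algebra)"

subsection \<open>The involution\<close>

text \<open>Values outside the algebra are normalised by the extensional function space
  (\<open>\<rightarrow>\<^sub>E\<close>), so that the involution is determined as a HOL function.\<close>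

definition is_involution :: "(('k::field_char_0) poly_map \<Rightarrow> 'k poly_map) \<Rightarrow> bool" where
  "is_involution \<theta> \<longleftrightarrow>
     (let A = (jacobian_algebra :: 'k poly_map ring) in
      \<theta> \<in> carrier A \<rightarrow>\<^sub>E carrier A \<and>
      bij_betw \<theta> (carrier A) (carrier A) \<and>
      \<theta> \<one>\<^bsub>A\<^esub> = \<one>\<^bsub>A\<^esub> \<and>
      (\<forall>a\<in>carrier A. \<forall>b\<in>carrier A. \<theta> (a \<oplus>\<^bsub>A\<^esub> b) = \<theta> a \<oplus>\<^bsub>A\<^esub> \<theta> b) \<and>
      (\<forall>a\<in>carrier A. \<forall>b\<in>carrier A. \<theta> (a \<otimes>\<^bsub>A\<^esub> b) = \<theta> b \<otimes>\<^bsub>A\<^esub> \<theta> a) \<and>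
      (\<forall>c. \<forall>a\<in>carrier A. \<theta> (\<lambda>p. smult c (a p)) = (\<lambda>p. smult c (\<theta> a p))) \<and>
      \<theta> X_op = D_op \<and> \<theta> D_op = X_op \<and> \<theta> H_inv = H_inv)"

definition involution :: "('k::field_char_0) poly_map \<Rightarrow> 'k poly_map" where
  "involution = (THE \<theta>. is_involution \<theta>)"

subsection \<open>The definitions above are meaningful\<close>

lemma linear_smult_iff:
  "Vector_Spaces.linear smult smult (f :: ('k::field_char_0) poly_map) \<longleftrightarrow>
     (\<forall>p q. f (p + q) = f p + f q) \<and> (\<forall>c p. f (smult c p) = smult c (f p))"
  (is "?L \<longleftrightarrow> ?R")
proof
  have v: "vector_space (smult :: 'k \<Rightarrow> _)"
    by unfold_locales (auto simp: smult_add_right smult_add_left)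
  assume ?R
  with v show ?L by (simp add: Vector_Spaces.linear_iff)
next
  assume ?L
  then show ?R by (simp add: Vector_Spaces.linear_iff)
qed

lemma End_poly_simps [simp]:
  "f \<in> carrier End_poly \<longleftrightarrow> Vector_Spaces.linear smult smult f"
  "f \<otimes>\<^bsub>End_poly\<^esub> g = f \<circ> g" "\<one>\<^bsub>End_poly\<^esub> = id" "\<zero>\<^bsub>End_poly\<^esub> = (\<lambda>p. 0)"
  "f \<oplus>\<^bsub>End_poly\<^esub> g = (\<lambda>p. f p + g p)"
  by (simp_all add: End_poly_def)

lemma jacobian_simps [simp]:
  "f \<otimes>\<^bsub>jacobian_algebra\<^esub> g = f \<circ> g" "\<one>\<^bsub>jacobian_algebra\<^esub> = id"
  "\<zero>\<^bsub>jacobian_algebra\<^esub> = (\<lambda>p. 0)" "f \<oplus>\<^bsub>jacobian_algebra\<^esub> g = (\<lambda>p. f p + g p)"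
  by (simp_all add: jacobian_algebra_def End_poly_def)

lemma ring_End_poly: "ring (End_poly :: ('k::field_char_0) poly_map ring)"
proof (rule ringI)
  show "abelian_group (End_poly :: 'k poly_map ring)"
  proof (rule abelian_groupI)
    fix f :: "'k poly_map" assume "f \<in> carrier End_poly"
    then have "(\<lambda>p. - f p) \<in> carrier End_poly" by (simp add: linear_smult_iff)
    then show "\<exists>g\<in>carrier End_poly. g \<oplus>\<^bsub>End_poly\<^esub> f = \<zero>\<^bsub>End_poly\<^esub>"
      by (rule bexI[rotated]) simp
  qed (auto simp: linear_smult_iff smult_add_right algebra_simps)
  show "monoid (End_poly :: 'k poly_map ring)"
    by (rule monoidI) (auto simp: linear_smult_iff)
qed (auto simp: linear_smult_iff fun_eq_iff)

lemma coeff_X_op: "coeff (X_op p) n = (case n of 0 \<Rightarrow> 0 | Suc m \<Rightarrow> coeff p m)"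
  by (simp add: X_op_def coeff_pCons split: nat.splits)

lemma coeff_D_op: "coeff (D_op p) n = of_nat (Suc n) * coeff p (Suc n)"
  by (simp add: D_op_def coeff_pderiv)

lemma coeff_H_op: "coeff (H_op p) n = of_nat (Suc n) * coeff p n"
  by (simp add: H_op_def coeff_D_op coeff_X_op del: of_nat_Suc)

lemma bij_H_op: "bij (H_op :: ('k::field_char_0) poly_map)"
proof (rule bijI)
  show "inj (H_op :: 'k poly_map)"
  proof (rule injI)
    fix p q :: "'k poly" assume "H_op p = H_op q"
    then have "coeff (H_op p) n = coeff (H_op q) n" for n by simp
    then show "p = q"
      by (simp add: coeff_H_op poly_eq_iff del: of_nat_Suc)
  qed
  show "surj (H_op :: 'k poly_map)"
  proof (rule surjI)
    fix p :: "'k poly"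
    define q where "q = (\<Sum>n\<le>degree p. monom (coeff p n / of_nat (Suc n)) n)"
    have "coeff q m = coeff p m / of_nat (Suc m)" for m
      by (cases "m \<le> degree p") (auto simp: q_def coeff_sum coeff_eq_0)
    then show "H_op (\<Sum>n\<le>degree p. monom (coeff p n / of_nat (Suc n)) n) = p"
      by (simp add: q_def[symmetric] poly_eq_iff coeff_H_op del: of_nat_Suc)
  qed
qed

lemma coeff_H_inv: "coeff (H_inv p) n = coeff p n / of_nat (Suc n)"
proof -
  have "H_op (H_inv p) = p"
    unfolding H_inv_def by (rule surj_f_inv_f[OF bij_is_surj[OF bij_H_op]])
  from arg_cong[OF this, of "\<lambda>p. coeff p n"] show ?thesis
    by (simp add: coeff_H_op field_simps del: of_nat_Suc)
qed

lemma gens_in_End: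
  "range smult \<union> {X_op, D_op, H_inv} \<subseteq> carrier (End_poly :: ('k::field_char_0) poly_map ring)"
  by (auto simp: linear_smult_iff smult_add_right poly_eq_iff coeff_X_op coeff_D_op coeff_H_inv
      algebra_simps add_divide_distrib split: nat.splits)

lemma ring_jacobian_algebra: "ring (jacobian_algebra :: ('k::field_char_0) poly_map ring)"
  unfolding jacobian_algebra_def by (rule ring.generate_ring_is_ring[OF ring_End_poly gens_in_End])

lemma carrier_jacobian:
  "carrier jacobian_algebra = generate_ring End_poly (range smult \<union> {X_op, D_op, H_inv})"
  by (simp add: jacobian_algebra_def)

lemma jacobian_linear:
  "a \<in> carrier jacobian_algebra \<Longrightarrow> Vector_Spaces.linear smult smult a"
  using ring.generate_ring_in_carrier[OF ring_End_poly gens_in_End]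
  by (auto simp: carrier_jacobian)

lemma End_poly_minus:
  fixes f :: "('k::field_char_0) poly_map"
  assumes "f \<in> carrier End_poly"
  shows "\<ominus>\<^bsub>End_poly\<^esub> f = (\<lambda>p. - f p)"
proof -
  interpret ring "End_poly :: 'k poly_map ring" by (rule ring_End_poly)
  have "(\<lambda>p. - f p) \<in> carrier End_poly" using assms by (simp add: linear_smult_iff)
  then show ?thesis using minus_equality[of "\<lambda>p. - f p" f] assms by simp
qed

lemma jacobian_closed:
  "smult c \<in> carrier jacobian_algebra" "X_op \<in> carrier jacobian_algebra"
  "D_op \<in> carrier jacobian_algebra" "H_inv \<in> carrier jacobian_algebra"
  "id \<in> carrier jacobian_algebra"
  "a \<in> carrier jacobian_algebra \<Longrightarrow> b \<in> carrier jacobian_algebra \<Longrightarrow>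
     a \<circ> b \<in> carrier jacobian_algebra"
  "a \<in> carrier jacobian_algebra \<Longrightarrow> b \<in> carrier jacobian_algebra \<Longrightarrow>
     (\<lambda>p. a p + b p) \<in> carrier jacobian_algebra"
  "a \<in> carrier jacobian_algebra \<Longrightarrow> (\<lambda>p. smult c (a p)) \<in> carrier jacobian_algebra"
proof -
  show m: "a \<in> carrier jacobian_algebra \<Longrightarrow> b \<in> carrier jacobian_algebra \<Longrightarrow>
     a \<circ> b \<in> carrier jacobian_algebra" for a b :: "'a poly_map"
    using generate_ring.eng_mult[of a End_poly _ b] by (simp add: carrier_jacobian)
  show "smult c \<in> carrier jacobian_algebra"
    by (simp add: carrier_jacobian generate_ring.incl)
  from m[OF this] show "a \<in> carrier jacobian_algebra \<Longrightarrow>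
      (\<lambda>p. smult c (a p)) \<in> carrier jacobian_algebra"
    by (simp add: comp_def)
  show "a \<in> carrier jacobian_algebra \<Longrightarrow> b \<in> carrier jacobian_algebra \<Longrightarrow>
     (\<lambda>p. a p + b p) \<in> carrier jacobian_algebra"
    using generate_ring.eng_add[of a End_poly _ b] by (simp add: carrier_jacobian)
  show "id \<in> carrier jacobian_algebra"
    using generate_ring.one[of End_poly] by (simp add: carrier_jacobian)
qed (simp_all add: carrier_jacobian generate_ring.incl)

lemma jacobian_induct [consumes 1, case_names smult X D Hinv add comp]:
  fixes a :: "('k::field_char_0) poly_map"
  assumes a: "a \<in> carrier jacobian_algebra"
    and "\<And>c. P (smult c)" "P X_op" "P D_op" "P H_inv"
    and add: "\<And>a b. a \<in> carrier jacobian_algebra \<Longrightarrow> b \<in> carrier jacobian_algebra \<Longrightarrow>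
           P a \<Longrightarrow> P b \<Longrightarrow> P (\<lambda>p. a p + b p)"
    and comp: "\<And>a b. a \<in> carrier jacobian_algebra \<Longrightarrow> b \<in> carrier jacobian_algebra \<Longrightarrow>
           P a \<Longrightarrow> P b \<Longrightarrow> P (a \<circ> b)"
  shows "P a"
  using a[unfolded carrier_jacobian]
proof (induction rule: generate_ring.induct)
  case one
  have "smult (1::'k) = id" by auto
  with assms(2)[of 1] show ?case by (simp only: End_poly_simps)
next
  case (a_inv h)
  have h: "h \<in> carrier jacobian_algebra" using a_inv by (simp add: carrier_jacobian)
  have "\<ominus>\<^bsub>End_poly\<^esub> h = smult (-1) \<circ> h"
    using End_poly_minus[of h] jacobian_linear[OF h] by auto
  with comp[OF jacobian_closed(1) h assms(2) a_inv.IH] show ?case by (simp only:)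
next
  case (incl h)
  then show ?case using assms(2-5) by blast
next
  case (eng_add g h)
  then show ?case unfolding End_poly_simps by (intro add) (simp_all add: carrier_jacobian)
next
  case (eng_mult g h)
  then show ?case unfolding End_poly_simps by (intro comp) (simp_all add: carrier_jacobian)
qed

text \<open>The involution is the adjoint for the form in which \<open>x\<^sup>i\<close>, \<open>x\<^sup>j\<close> pair to
  \<open>i! \<delta>\<^sub>i\<^sub>j\<close>.\<close>

definition fischer :: "('k::field_char_0) poly \<Rightarrow> 'k poly \<Rightarrow> 'k" where
  "fischer p q = (\<Sum>n\<le>degree p. fact n * coeff p n * coeff q n)"

lemma fischer_eq:
  assumes "degree p \<le> N \<or> degree q \<le> N"
  shows "fischer p q = (\<Sum>n\<le>N. fact n * coeff p n * coeff q n)"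
proof -
  let ?f = "\<lambda>n. fact n * coeff p n * coeff q n"
  have "sum ?f {..degree p} = sum ?f {..max (degree p) N}"
    by (rule sum.mono_neutral_left) (auto simp: coeff_eq_0)
  also have "\<dots> = sum ?f {..N}"
    by (rule sum.mono_neutral_right) (use assms in \<open>auto simp: coeff_eq_0\<close>)
  finally show ?thesis by (simp only: fischer_def)
qed

lemma fischer_sym: "fischer p q = fischer q p"
  using fischer_eq[of q "degree p" p] by (simp add: fischer_def mult_ac)

lemma fischer_add_right: "fischer p (q + r) = fischer p q + fischer p r"
  by (simp add: fischer_def algebra_simps sum.distrib)

lemma fischer_add_left: "fischer (q + r) p = fischer q p + fischer r p"
  by (metis fischer_sym fischer_add_right)

lemma fischer_smult_right: "fischer p (smult c q) = c * fischer p q"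
  by (simp add: fischer_def sum_distrib_left mult_ac)

lemma fischer_smult_left: "fischer (smult c q) p = c * fischer q p"
  by (metis fischer_sym fischer_smult_right)

lemma fischer_monom: "fischer (monom 1 n) q = fact n * coeff q n"
proof -
  have "fischer (monom 1 n) q = (\<Sum>k\<le>n. if k = n then fact n * coeff q n else 0)"
    unfolding fischer_def degree_monom_eq[OF one_neq_zero] by (rule sum.cong) auto
  then show ?thesis by simp
qed

lemma fischer_X: "fischer (X_op p) q = fischer p (D_op q)"
proof -
  define N where "N = degree p"
  have "degree (X_op p) \<le> Suc N"
    unfolding X_op_def N_def by (simp add: degree_pCons_le)
  then have "fischer (X_op p) q = (\<Sum>n\<le>Suc N. fact n * coeff (X_op p) n * coeff q n)"
    by (intro fischer_eq) auto
  also have "\<dots> = (\<Sum>n\<le>N. fact (Suc n) * coeff p n * coeff q (Suc n))"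
    by (subst sum.atMost_Suc_shift) (simp add: coeff_X_op)
  also have "\<dots> = fischer p (D_op q)"
    by (simp add: fischer_def N_def coeff_D_op mult_ac)
  finally show ?thesis .
qed

lemma fischer_H_inv: "fischer (H_inv p) q = fischer p (H_inv q)"
proof -
  define N where "N = max (degree p) (degree (H_inv p))"
  have "fischer (H_inv p) q = (\<Sum>n\<le>N. fact n * coeff (H_inv p) n * coeff q n)"
    "fischer p (H_inv q) = (\<Sum>n\<le>N. fact n * coeff p n * coeff (H_inv q) n)"
    by (intro fischer_eq; auto simp: N_def)+
  then show ?thesis by (simp add: coeff_H_inv del: of_nat_Suc)
qed

definition adj :: "('k::field_char_0) poly_map \<Rightarrow> 'k poly_map \<Rightarrow> bool" where
  "adj a b \<longleftrightarrow> (\<forall>p q. fischer (a p) q = fischer p (b q))"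

lemma adj_sym: "adj a b \<Longrightarrow> adj b a"
  unfolding adj_def by (metis fischer_sym)

lemma adj_unique: "adj a b \<Longrightarrow> adj a c \<Longrightarrow> b = c"
proof (rule ext)
  fix q assume "adj a b" "adj a c"
  then have "fischer (monom 1 n) (b q) = fischer (monom 1 n) (c q)" for n
    unfolding adj_def by metis
  then show "b q = c q" by (simp add: fischer_monom poly_eq_iff)
qed

lemma adj_rules:
  "adj (smult c) (smult c)" "adj X_op D_op" "adj D_op X_op" "adj H_inv H_inv" "adj id id"
  "adj a a' \<Longrightarrow> adj b b' \<Longrightarrow> adj (\<lambda>p. a p + b p) (\<lambda>p. a' p + b' p)"
  "adj a a' \<Longrightarrow> adj b b' \<Longrightarrow> adj (a \<circ> b) (b' \<circ> a')"
  "adj a a' \<Longrightarrow> adj (\<lambda>p. smult c (a p)) (\<lambda>p. smult c (a' p))"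
proof -
  show X: "adj X_op D_op" by (simp add: adj_def fischer_X)
  then show "adj D_op X_op" by (rule adj_sym)
  show "adj (smult c) (smult c)" for c :: 'a
    by (simp add: adj_def fischer_smult_left fischer_smult_right)
  show "adj H_inv H_inv" by (simp add: adj_def fischer_H_inv)
  show "adj id id" by (simp add: adj_def)
  show "adj a a' \<Longrightarrow> adj b b' \<Longrightarrow> adj (\<lambda>p. a p + b p) (\<lambda>p. a' p + b' p)"
    for a a' b b' :: "'a poly_map"
    unfolding adj_def fischer_add_left fischer_add_right by metis
  show "adj a a' \<Longrightarrow> adj b b' \<Longrightarrow> adj (a \<circ> b) (b' \<circ> a')"
    for a a' b b' :: "'a poly_map"
    unfolding adj_def comp_apply by metis
  show "adj a a' \<Longrightarrow> adj (\<lambda>p. smult c (a p)) (\<lambda>p. smult c (a' p))"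
    for a a' :: "'a poly_map" and c
    unfolding adj_def fischer_smult_left fischer_smult_right by metis
qed

lemma adj_exists:
  fixes a :: "('k::field_char_0) poly_map"
  assumes "a \<in> carrier jacobian_algebra"
  shows "\<exists>b\<in>carrier jacobian_algebra. adj a b"
  using assms
proof (induction a rule: jacobian_induct)
  case (smult c)
  show ?case by (rule bexI[where x = "smult c"]) (rule adj_rules jacobian_closed)+
next
  case X
  show ?case by (rule bexI[where x = "D_op"]) (rule adj_rules jacobian_closed)+
next
  case D
  show ?case by (rule bexI[where x = "X_op"]) (rule adj_rules jacobian_closed)+
next
  case Hinv
  show ?case by (rule bexI[where x = "H_inv"]) (rule adj_rules jacobian_closed)+
next
  case (add a b)
  obtain a' b' where "a' \<in> carrier jacobian_algebra" "adj a a'"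
    "b' \<in> carrier jacobian_algebra" "adj b b'" using add.IH by (elim bexE) (rule that)
  then show ?case by (intro bexI[where x = "\<lambda>p. a' p + b' p"] adj_rules(6) jacobian_closed(7))
next
  case (comp a b)
  obtain a' b' where "a' \<in> carrier jacobian_algebra" "adj a a'"
    "b' \<in> carrier jacobian_algebra" "adj b b'" using comp.IH by (elim bexE) (rule that)
  then show ?case by (intro bexI[where x = "b' \<circ> a'"] adj_rules(7) jacobian_closed(6))
qed

lemma involution_ex1: "\<exists>!\<theta> :: ('k::field_char_0) poly_map \<Rightarrow> 'k poly_map. is_involution \<theta>"
proof (rule ex_ex1I)
  let ?A = "carrier (jacobian_algebra :: 'k poly_map ring)"
  define \<theta> where "\<theta> = (\<lambda>a\<in>?A. SOME b. b \<in> ?A \<and> adj a b)"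
  have \<theta>: "\<theta> a \<in> ?A" "adj a (\<theta> a)" if "a \<in> ?A" for a
    using someI_ex[OF adj_exists[OF that, unfolded Bex_def]] that by (auto simp: \<theta>_def)
  have eq: "\<theta> a = b" if "a \<in> ?A" "adj a b" for a b
    using adj_unique[OF \<theta>(2)] that by blast
  have inv: "\<theta> (\<theta> a) = a" if "a \<in> ?A" for a
    using eq[OF \<theta>(1)[OF that] adj_sym[OF \<theta>(2)[OF that]]] .
  have "bij_betw \<theta> ?A ?A"
    by (rule bij_betw_byWitness[where f' = \<theta>]) (use inv \<theta> in auto)
  moreover have "\<theta> \<in> ?A \<rightarrow>\<^sub>E ?A" using \<theta> by (auto simp: \<theta>_def)
  ultimately have "is_involution \<theta>"
    unfolding is_involution_def Let_def jacobian_simps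
    by (intro conjI ballI allI eq jacobian_closed adj_rules \<theta>)
  then show "\<exists>\<theta> :: 'k poly_map \<Rightarrow> 'k poly_map. is_involution \<theta>"
    by (rule exI[where x = \<theta>])
next
  let ?A = "carrier (jacobian_algebra :: 'k poly_map ring)"
  fix \<theta> \<phi> :: "'k poly_map \<Rightarrow> 'k poly_map"
  assume t: "is_involution \<theta>" and f: "is_involution \<phi>"
  note D = is_involution_def Let_def jacobian_simps
  have sc: "\<psi> (smult c) = smult c" if "is_involution \<psi>" for \<psi> :: "'k poly_map \<Rightarrow> 'k poly_map" and c
  proof -
    have "\<psi> (\<lambda>p. smult c (id p)) = (\<lambda>p. smult c (\<psi> id p))" "\<psi> id = id"
      using that jacobian_closed(5) unfolding D by blast+
    then show ?thesis by simp
  qed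
  have pres: "\<psi> (\<lambda>p. a p + b p) = (\<lambda>p. \<psi> a p + \<psi> b p)"
    "\<psi> (a \<circ> b) = \<psi> b \<circ> \<psi> a"
    if "is_involution \<psi>" "a \<in> ?A" "b \<in> ?A" for \<psi> :: "'k poly_map \<Rightarrow> 'k poly_map" and a b
    using that unfolding D by blast+
  have gens: "\<psi> X_op = D_op" "\<psi> D_op = X_op" "\<psi> H_inv = H_inv" "\<psi> \<in> ?A \<rightarrow>\<^sub>E ?A"
    if "is_involution \<psi>" for \<psi> :: "'k poly_map \<Rightarrow> 'k poly_map"
    using that unfolding D by blast+
  have "\<theta> a = \<phi> a" if "a \<in> ?A" for a
    using that
  proof (induction a rule: jacobian_induct)
    case (smult c)
    show ?case by (simp only: sc[OF t] sc[OF f])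
  next
    case X
    show ?case by (simp only: gens[OF t] gens[OF f])
  next
    case D
    show ?case by (simp only: gens[OF t] gens[OF f])
  next
    case Hinv
    show ?case by (simp only: gens[OF t] gens[OF f])
  next
    case (add a b)
    then show ?case by (simp only: pres(1)[OF t] pres(1)[OF f])
  next
    case (comp a b)
    then show ?case by (simp only: pres(2)[OF t] pres(2)[OF f])
  qed
  then show "\<theta> = \<phi>"
    by (rule PiE_ext[OF gens(4)[OF t] gens(4)[OF f]])
qed

lemma is_involution_involution: "is_involution (involution :: ('k::field_char_0) poly_map \<Rightarrow> _)"
  unfolding involution_def by (rule theI'[OF involution_ex1])

end

theory Submission
  imports Defs
begin

text \<open>Transposition with respect to the Fischer form exchanges left and right regular elements,
  and an element is right regular iff it is injective on \<open>K[x]\<close>, because every operator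
  \<open>p \<mapsto> p(0) v\<close> lies in the algebra. Every element of the algebra is a band matrix whose
  diagonals agree, far out, with rational functions of the column index. Such a function is eventually
  zero or eventually nonzero, so an element \<open>b\<close> outside \<open>F\<close> shifts the degree of all monomials
  \<open>x\<^sup>k\<close> with \<open>k\<close> large by the same amount; hence \<open>b x\<^sup>N\<close> is injective for large \<open>N\<close>. Transposing,
  \<open>\<partial>\<^sup>N a\<close> is left regular for every \<open>a\<close> outside \<open>F\<close>.\<close>

section \<open>Linear endomorphisms of \<open>K[x]\<close> and their values on monomials\<close>

lemma linear_sum:
  fixes f :: "('k::field_char_0) poly_map"
  assumes "Vector_Spaces.linear smult smult f"
  shows "f (sum g S) = (\<Sum>i\<in>S. f (g i))"
proof -
  have "f 0 = 0" using assms unfolding linear_smult_iff by (metis smult_0_left)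
  with assms show ?thesis by (induction S rule: infinite_finite_induct) (auto simp: linear_smult_iff)
qed

lemma linear_expansion:
  fixes f :: "('k::field_char_0) poly_map"
  assumes "Vector_Spaces.linear smult smult f" and "degree p \<le> N"
  shows "f p = (\<Sum>k\<le>N. smult (coeff p k) (f (monom 1 k)))"
proof -
  have "p = (\<Sum>k\<le>N. smult (coeff p k) (monom 1 k))"
    using poly_as_sum_of_monoms'[OF assms(2)] by (simp add: smult_monom)
  then have "f p = f (\<Sum>k\<le>N. smult (coeff p k) (monom 1 k))" by simp
  also have "\<dots> = (\<Sum>k\<le>N. smult (coeff p k) (f (monom 1 k)))"
    using assms(1) by (subst linear_sum) (auto simp: linear_smult_iff)
  finally show ?thesis .
qed

subsection \<open>Sequences that are eventually rational\<close>

text \<open>The denominator is multiplied out, so its finitely many roots need no separate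
  treatment; finitely many values of \<open>f\<close> are left free.\<close>

definition eventually_rational :: "(nat \<Rightarrow> 'k::field_char_0) \<Rightarrow> bool" where
  "eventually_rational f \<longleftrightarrow>
     (\<exists>p q. q \<noteq> 0 \<and> (\<forall>\<^sub>F k in sequentially. poly q (of_nat k) * f k = poly p (of_nat k)))"

text \<open>Characteristic zero enters here: \<open>of_nat\<close> is injective, so the finitely
  many roots of \<open>p\<close> meet only finitely many natural numbers.\<close>

lemma eventually_poly_nonzero:
  fixes p :: "'k::field_char_0 poly"
  assumes "p \<noteq> 0"
  shows "\<forall>\<^sub>F k in sequentially. poly p (of_nat k) \<noteq> 0"
proof -
  have "finite (of_nat -` {x. poly p x = 0} :: nat set)"
    by (rule finite_vimageI[OF poly_roots_finite[OF assms]]) (auto simp: inj_on_def)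
  then show ?thesis
    by (simp add: cofinite_eq_sequentially[symmetric] eventually_cofinite vimage_def)
qed

text \<open>Where \<open>q * f = p\<close> holds, \<open>f\<close> vanishes off the roots of
  \<open>q\<close> if \<open>p = 0\<close>, and is nonzero off the roots of \<open>p\<close>
  otherwise; in both cases only finitely many \<open>k\<close> are lost.\<close>

lemma eventually_rational_dichotomy:
  assumes "eventually_rational f"
  shows "(\<forall>\<^sub>F k in sequentially. f k = 0) \<or> (\<forall>\<^sub>F k in sequentially. f k \<noteq> 0)"
proof -
  obtain p q where q: "q \<noteq> 0"
    and e: "\<forall>\<^sub>F k in sequentially. poly q (of_nat k) * f k = poly p (of_nat k)"
    using assms unfolding eventually_rational_def by auto
  show ?thesis
  proof (cases "p = 0")
    case True
    have "\<forall>\<^sub>F k in sequentially. f k = 0"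
      using e eventually_poly_nonzero[OF q] by eventually_elim (simp add: True)
    then show ?thesis ..
  next
    case False
    have "\<forall>\<^sub>F k in sequentially. f k \<noteq> 0"
      using e eventually_poly_nonzero[OF False] by eventually_elim auto
    then show ?thesis ..
  qed
qed

lemma eventually_rational_poly: "eventually_rational (\<lambda>k. poly p (of_nat k))"
  unfolding eventually_rational_def by (intro exI[of _ p] exI[of _ 1]) simp

lemma eventually_rational_const: "eventually_rational (\<lambda>k. c)"
  using eventually_rational_poly[of "[:c:]"] by simp

lemma eventually_rational_of_nat: "eventually_rational of_nat"
  using eventually_rational_poly[of "[:0, 1:]"] by simp

lemma eventually_rational_inverse_Suc: "eventually_rational (\<lambda>k. 1 / of_nat (Suc k))"
proof -
  have "poly [:1, 1:] (of_nat k :: 'a) * (1 / of_nat (Suc k)) = 1" for k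
    using of_nat_neq_0[of k, where 'a = 'a] by (simp add: divide_simps add.commute)
  then show ?thesis
    unfolding eventually_rational_def by (intro exI[of _ 1] exI[of _ "[:1, 1:]"]) simp
qed

lemma eventually_rational_add:
  assumes "eventually_rational f" "eventually_rational g"
  shows "eventually_rational (\<lambda>k. f k + g k)"
proof -
  obtain p q p' q' where q: "q \<noteq> 0" "q' \<noteq> 0"
    and e: "\<forall>\<^sub>F k in sequentially. poly q (of_nat k) * f k = poly p (of_nat k)"
      "\<forall>\<^sub>F k in sequentially. poly q' (of_nat k) * g k = poly p' (of_nat k)"
    using assms unfolding eventually_rational_def by auto
  from e have "\<forall>\<^sub>F k in sequentially.
      poly (q * q') (of_nat k) * (f k + g k) = poly (p * q' + q * p') (of_nat k)"
  proof eventually_elim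
    case (elim k)
    have "poly (q * q') (of_nat k) * (f k + g k) =
        (poly q (of_nat k) * f k) * poly q' (of_nat k) +
        poly q (of_nat k) * (poly q' (of_nat k) * g k)"
      by (simp add: algebra_simps)
    then show ?case by (simp only: elim poly_add poly_mult)
  qed
  moreover have "q * q' \<noteq> 0" using q by simp
  ultimately show ?thesis unfolding eventually_rational_def by blast
qed

lemma eventually_rational_mult:
  assumes "eventually_rational f" "eventually_rational g"
  shows "eventually_rational (\<lambda>k. f k * g k)"
proof -
  obtain p q p' q' where q: "q \<noteq> 0" "q' \<noteq> 0"
    and e: "\<forall>\<^sub>F k in sequentially. poly q (of_nat k) * f k = poly p (of_nat k)"
      "\<forall>\<^sub>F k in sequentially. poly q' (of_nat k) * g k = poly p' (of_nat k)"
    using assms unfolding eventually_rational_def by auto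
  from e have "\<forall>\<^sub>F k in sequentially.
      poly (q * q') (of_nat k) * (f k * g k) = poly (p * p') (of_nat k)"
  proof eventually_elim
    case (elim k)
    have "poly (q * q') (of_nat k) * (f k * g k) =
        (poly q (of_nat k) * f k) * (poly q' (of_nat k) * g k)"
      by (simp add: algebra_simps)
    then show ?case by (simp only: elim poly_mult)
  qed
  moreover have "q * q' \<noteq> 0" using q by simp
  ultimately show ?thesis unfolding eventually_rational_def by blast
qed

lemma eventually_rational_sum:
  assumes "\<And>i. i \<in> S \<Longrightarrow> eventually_rational (f i)"
  shows "eventually_rational (\<lambda>k. \<Sum>i\<in>S. f i k)"
  using assms
  by (induction S rule: infinite_finite_induct)
    (auto intro: eventually_rational_const eventually_rational_add)

lemma filterlim_nat_shift: "filterlim (\<lambda>k::nat. k + i - n) sequentially sequentially"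
  unfolding filterlim_at_top
proof
  fix Z
  show "\<forall>\<^sub>F k in sequentially. Z \<le> k + i - n"
    using eventually_ge_at_top[of "Z + n"] by eventually_elim linarith
qed

lemma eventually_rational_shift:
  fixes f :: "nat \<Rightarrow> 'k::field_char_0"
  assumes "eventually_rational f"
  shows "eventually_rational (\<lambda>k. f (k + i - n))"
proof -
  obtain p q where q: "q \<noteq> 0"
    and e: "\<forall>\<^sub>F k in sequentially. poly q (of_nat k) * f k = poly p (of_nat k)"
    using assms unfolding eventually_rational_def by auto
  \<comment> \<open>Once \<open>k \<ge> n\<close>, the truncated \<open>k + i - n\<close> is the
    value of this linear polynomial at \<open>k\<close>. Being nonconstant, it does not turn
    \<open>q\<close> into zero under composition.\<close>
  let ?s = "[:of_nat i - of_nat n, 1:] :: 'k poly"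
  have "\<forall>\<^sub>F k in sequentially.
      poly q (of_nat (k + i - n)) * f (k + i - n) = poly p (of_nat (k + i - n))"
    using eventually_compose_filterlim[OF e filterlim_nat_shift] .
  then have "\<forall>\<^sub>F k in sequentially.
      poly (pcompose q ?s) (of_nat k) * f (k + i - n) = poly (pcompose p ?s) (of_nat k)"
    using eventually_ge_at_top[of n]
    by eventually_elim (simp add: poly_pcompose of_nat_diff algebra_simps)
  moreover have "pcompose q ?s \<noteq> 0" using q pcompose_eq_0[of q ?s] by auto
  ultimately show ?thesis unfolding eventually_rational_def by blast
qed

subsection \<open>Band operators\<close>

text \<open>The power \<open>x\<^bsup>k - n\<^esup>\<close> accounts for operators lowering the degree; for \<open>k < n\<close> the truncated
  exponent is harmless since only large \<open>k\<close> matter.\<close>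

definition rational_band ::
    "('k::field_char_0) poly_map \<Rightarrow> nat \<Rightarrow> nat \<Rightarrow> (nat \<Rightarrow> 'k poly) \<Rightarrow> bool" where
  "rational_band a n m \<Phi> \<longleftrightarrow>
     (\<forall>k. degree (\<Phi> k) \<le> m) \<and> (\<forall>j. eventually_rational (\<lambda>k. coeff (\<Phi> k) j)) \<and>
     (\<forall>\<^sub>F k in sequentially. a (monom 1 k) = monom 1 (k - n) * \<Phi> k)"

text \<open>Moving a factor \<open>x^d\<close> from the monomial into the coefficient polynomial
  changes the offset of the band but not the operator. This is how two summands get a common
  offset.\<close>

lemma rational_band_raise:
  assumes "rational_band a n m \<Phi>"
  shows "rational_band a (n + d) (m + d) (\<lambda>k. monom 1 d * \<Phi> k)"
  unfolding rational_band_def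
proof (intro conjI allI)
  fix k
  have "degree (\<Phi> k) \<le> m" using assms by (simp add: rational_band_def)
  then show "degree (monom 1 d * \<Phi> k) \<le> m + d"
    using degree_mult_le[of "monom 1 d" "\<Phi> k"] degree_monom_eq[of "1::'a" d] by simp
next
  fix j
  show "eventually_rational (\<lambda>k. coeff (monom 1 d * \<Phi> k) j)"
    using assms by (cases "d \<le> j")
      (auto simp: coeff_monom_mult rational_band_def intro: eventually_rational_const)
next
  have "\<forall>\<^sub>F k in sequentially. a (monom 1 k) = monom 1 (k - n) * \<Phi> k"
    using assms by (simp add: rational_band_def)
  then show "\<forall>\<^sub>F k in sequentially. a (monom 1 k) = monom 1 (k - (n + d)) * (monom 1 d * \<Phi> k)"
    using eventually_ge_at_top[of "n + d"]
    by eventually_elim (simp add: mult_monom flip: mult.assoc)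
qed

lemma rational_band_add:
  assumes "rational_band a n m \<Phi>" "rational_band b n' m' \<Psi>"
  shows "\<exists>n m \<Phi>. rational_band (\<lambda>p. a p + b p) n m \<Phi>"
proof -
  define A B where "A = (\<lambda>k. monom 1 n' * \<Phi> k)" and "B = (\<lambda>k. monom 1 n * \<Psi> k)"
  have A: "rational_band a (n + n') (m + n') A" and B: "rational_band b (n + n') (m' + n) B"
    using rational_band_raise[OF assms(1), of n'] rational_band_raise[OF assms(2), of n]
    by (simp_all add: A_def B_def add.commute)
  have "rational_band (\<lambda>p. a p + b p) (n + n') (max (m + n') (m' + n)) (\<lambda>k. A k + B k)"
    unfolding rational_band_def
  proof (intro conjI allI)
    show "degree (A k + B k) \<le> max (m + n') (m' + n)" for k
      using A B by (intro degree_add_le) (auto simp: rational_band_def le_max_iff_disj)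
    show "eventually_rational (\<lambda>k. coeff (A k + B k) j)" for j
      using A B by (auto simp: rational_band_def intro: eventually_rational_add)
    have "\<forall>\<^sub>F k in sequentially. a (monom 1 k) = monom 1 (k - (n + n')) * A k"
      "\<forall>\<^sub>F k in sequentially. b (monom 1 k) = monom 1 (k - (n + n')) * B k"
      using A B by (auto simp: rational_band_def)
    then show "\<forall>\<^sub>F k in sequentially.
        a (monom 1 k) + b (monom 1 k) = monom 1 (k - (n + n')) * (A k + B k)"
      by eventually_elim (simp add: algebra_simps)
  qed
  then show ?thesis by blast
qed

text \<open>For large \<open>k\<close>, \<open>b\<close> sends \<open>x^k\<close> to a combination
  of the \<open>x^(k+i-n')\<close> with coefficients rational in \<open>k\<close>. Applying
  \<open>a\<close> multiplies these by shifted coefficients of \<open>a\<close>, and shifts,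
  products and finite sums stay eventually rational.\<close>

lemma rational_band_comp:
  assumes lin: "Vector_Spaces.linear smult smult a"
    and A: "rational_band a n m \<Phi>" and B: "rational_band b n' m' \<Psi>"
  shows "\<exists>n m \<Phi>. rational_band (a \<circ> b) n m \<Phi>"
proof -
  define \<Theta> where "\<Theta> = (\<lambda>k. \<Sum>i\<le>m'. monom (coeff (\<Psi> k) i) i * \<Phi> (k + i - n'))"
  have "rational_band (a \<circ> b) (n + n') (m' + m) \<Theta>"
    unfolding rational_band_def
  proof (intro conjI allI)
    fix k
    have "degree (monom (coeff (\<Psi> k) i) i * \<Phi> (k + i - n')) \<le> m' + m" if "i \<le> m'" for i
      using that A
      by (intro order_trans[OF degree_mult_le] add_mono order_trans[OF degree_monom_le])
        (auto simp: rational_band_def)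
    then show "degree (\<Theta> k) \<le> m' + m"
      unfolding \<Theta>_def by (intro degree_sum_le) auto
  next
    fix j
    have "eventually_rational (\<lambda>k. coeff (monom (coeff (\<Psi> k) i) i * \<Phi> (k + i - n')) j)" for i
    proof (cases "i \<le> j")
      case True
      have "eventually_rational (\<lambda>k. coeff (\<Psi> k) i * coeff (\<Phi> (k + i - n')) (j - i))"
        using A B eventually_rational_shift[of "\<lambda>k. coeff (\<Phi> k) (j - i)" i n']
        by (intro eventually_rational_mult) (auto simp: rational_band_def)
      then show ?thesis using True by (simp add: coeff_monom_mult)
    qed (simp add: coeff_monom_mult eventually_rational_const)
    then show "eventually_rational (\<lambda>k. coeff (\<Theta> k) j)"
      unfolding \<Theta>_def coeff_sum by (intro eventually_rational_sum)
  next
    have "\<forall>\<^sub>F k in sequentially. a (monom 1 k) = monom 1 (k - n) * \<Phi> k"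
      using A by (simp add: rational_band_def)
    \<comment> \<open>Only the finitely many \<open>i \<le> m'\<close> occur, so one threshold
      serves all shifted columns.\<close>
    then have "\<forall>\<^sub>F k in sequentially. \<forall>i\<in>{..m'}.
        a (monom 1 (k + i - n')) = monom 1 (k + i - n' - n) * \<Phi> (k + i - n')"
      by (intro eventually_ball_finite ballI eventually_compose_filterlim[OF _ filterlim_nat_shift])
        auto
    moreover have "\<forall>\<^sub>F k in sequentially. b (monom 1 k) = monom 1 (k - n') * \<Psi> k"
      using B by (simp add: rational_band_def)
    ultimately show "\<forall>\<^sub>F k in sequentially.
        (a \<circ> b) (monom 1 k) = monom 1 (k - (n + n')) * \<Theta> k"
      using eventually_ge_at_top[of "n + n'"]
    proof eventually_elim
      case (elim k)
      have "degree (\<Psi> k) \<le> m'" using B by (simp add: rational_band_def)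
      then have "\<Psi> k = (\<Sum>i\<le>m'. monom (coeff (\<Psi> k) i) i)"
        by (rule poly_as_sum_of_monoms'[symmetric])
      then have "b (monom 1 k) = monom 1 (k - n') * (\<Sum>i\<le>m'. monom (coeff (\<Psi> k) i) i)"
        using elim by simp
      also have "\<dots> = (\<Sum>i\<le>m'. smult (coeff (\<Psi> k) i) (monom 1 (k + i - n')))"
        using elim by (simp add: sum_distrib_left mult_monom smult_monom)
      finally have "a (b (monom 1 k)) =
          (\<Sum>i\<le>m'. smult (coeff (\<Psi> k) i) (a (monom 1 (k + i - n'))))"
        using lin by (simp add: linear_sum linear_smult_iff)
      \<comment> \<open>For \<open>k \<ge> n + n'\<close> no subtraction is truncated, and
        \<open>x^(k+i-n'-n)\<close> splits as \<open>x^(k-(n+n'))\<close> times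
        \<open>x^i\<close>.\<close>
      also have "\<dots> = (\<Sum>i\<le>m'. monom 1 (k - (n + n')) *
          (monom (coeff (\<Psi> k) i) i * \<Phi> (k + i - n')))"
        using elim
        by (intro sum.cong refl) (simp add: mult_monom smult_monom add.commute[of n' n] flip: mult.assoc mult_smult_left)
      finally show ?case by (simp add: \<Theta>_def sum_distrib_left)
    qed
  qed
  then show ?thesis by blast
qed

lemma jacobian_rational_band:
  fixes a :: "('k::field_char_0) poly_map"
  assumes "a \<in> carrier jacobian_algebra"
  shows "\<exists>n m \<Phi>. rational_band a n m \<Phi>"
  using assms
proof (induction a rule: jacobian_induct)
  case (smult c)
  have "rational_band (smult c) 0 0 (\<lambda>k. [:c:])"
    by (auto simp: rational_band_def eventually_rational_const)
  then show ?case by blast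
next
  case X
  have "rational_band (X_op :: 'k poly_map) 0 1 (\<lambda>k. [:0, 1:])"
    by (auto simp: rational_band_def eventually_rational_const X_op_def)
  then show ?case by blast
next
  case D
  \<comment> \<open>At \<open>k = 0\<close> the factor \<open>of_nat k\<close> vanishes, so the
    truncated exponent does no harm.\<close>
  have "D_op (monom 1 k :: 'k poly) = monom 1 (k - 1) * [:of_nat k:]" for k
    by (simp add: D_op_def pderiv_monom smult_monom)
  moreover have "eventually_rational (\<lambda>k. coeff [:of_nat k :: 'k:] j)" for j
    by (cases j) (simp_all add: eventually_rational_const eventually_rational_of_nat)
  ultimately have "rational_band (D_op :: 'k poly_map) 1 0 (\<lambda>k. [:of_nat k:])"
    by (simp add: rational_band_def)
  then show ?case by blast
next
  case Hinv
  \<comment> \<open>These eigenvalues are the reason for rational rather than polynomial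
    diagonals.\<close>
  have "H_inv (monom 1 k :: 'k poly) = monom 1 k * [:1 / of_nat (Suc k):]" for k
    by (rule poly_eqI) (simp add: coeff_H_inv smult_monom del: of_nat_Suc)
  moreover have "eventually_rational (\<lambda>k. coeff [:1 / of_nat (Suc k) :: 'k:] j)" for j
    by (cases j)
      (simp_all add: eventually_rational_const eventually_rational_inverse_Suc del: of_nat_Suc)
  ultimately have "rational_band (H_inv :: 'k poly_map) 0 0 (\<lambda>k. [:1 / of_nat (Suc k):])"
    by (simp add: rational_band_def del: of_nat_Suc)
  then show ?case by blast
next
  case (add a b)
  then show ?case using rational_band_add by blast
next
  case (comp a b)
  then show ?case using rational_band_comp[OF jacobian_linear] by blast
qed

subsection \<open>The ideal \<open>F\<close>\<close>

text \<open>Only the columns \<open>a (monom 1 k)\<close> with \<open>k < N\<close> can be nonzero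
  and each is a polynomial, so the matrix of \<open>a\<close> has finitely many nonzero
  entries.\<close>

lemma F_idealI:
  fixes a :: "('k::field_char_0) poly_map"
  assumes lin: "Vector_Spaces.linear smult smult a"
    and zero: "\<And>k. k \<ge> N \<Longrightarrow> a (monom 1 k) = 0"
  shows "a \<in> F_ideal"
proof -
  define M where "M = Max ((\<lambda>k. degree (a (monom 1 k))) ` {..N})"
  have M: "degree (a (monom 1 k)) \<le> M" if "k \<le> N" for k
    using that by (auto simp: M_def)
  let ?c = "\<lambda>i j. coeff (a (monom 1 j)) i"
  have "a p = (\<Sum>(i, j)\<in>{..M} \<times> {..N}. smult (?c i j) (E_op i j p))" for p
  proof -
    have "a p = (\<Sum>k\<le>max N (degree p). smult (coeff p k) (a (monom 1 k)))"
      by (intro linear_expansion lin) simp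
    also have "\<dots> = (\<Sum>k\<le>N. smult (coeff p k) (a (monom 1 k)))"
      by (rule sum.mono_neutral_right) (auto simp: zero)
    also have "\<dots> = (\<Sum>k\<le>N. \<Sum>i\<le>M. smult (?c i k) (E_op i k p))"
    proof (rule sum.cong[OF refl])
      fix k assume "k \<in> {..N}"
      then have "a (monom 1 k) = (\<Sum>i\<le>M. monom (?c i k) i)"
        using poly_as_sum_of_monoms'[OF M] by simp
      then have "smult (coeff p k) (a (monom 1 k)) = smult (coeff p k) (\<Sum>i\<le>M. monom (?c i k) i)"
        by simp
      also have "\<dots> = (\<Sum>i\<le>M. smult (?c i k) (E_op i k p))"
        by (subst linear_sum)
            (auto simp: linear_smult_iff smult_add_right smult_monom E_op_def mult.commute)
      finally show "smult (coeff p k) (a (monom 1 k)) = (\<Sum>i\<le>M. smult (?c i k) (E_op i k p))" .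
    qed
    also have "\<dots> = (\<Sum>i\<le>M. \<Sum>k\<le>N. smult (?c i k) (E_op i k p))" by (rule sum.swap)
    finally show ?thesis by (simp add: sum.cartesian_product)
  qed
  then have "a = (\<lambda>p. \<Sum>(i, j)\<in>{..M} \<times> {..N}. smult (?c i j) (E_op i j p))" by blast
  then show ?thesis
    unfolding F_ideal_def
    by (intro CollectI exI[of _ ?c] exI[of _ "{..M} \<times> {..N}"]) auto
qed

text \<open>A finite matrix is bounded in both directions: the column bound yields a kernel, and the
  row bound becomes a column bound under transposition.\<close>

lemma F_idealE:
  fixes a :: "('k::field_char_0) poly_map"
  assumes "a \<in> F_ideal"
  obtains N where "\<And>k. k \<ge> N \<Longrightarrow> a (monom 1 k) = 0" and "\<And>k p. k \<ge> N \<Longrightarrow> coeff (a p) k = 0"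
proof -
  obtain c S where S: "finite S"
    and a: "a = (\<lambda>p. \<Sum>(i, j)\<in>S. smult (c i j) (E_op i j p))"
    using assms unfolding F_ideal_def by blast
  \<comment> \<open>For empty \<open>S\<close> the maximum is unspecified, but then \<open>a\<close>
    is zero and any \<open>N\<close> will do.\<close>
  define N where "N = Suc (Max (fst ` S \<union> snd ` S))"
  have N: "i < N" "j < N" if "(i, j) \<in> S" for i j
    using that S by (force simp: N_def less_Suc_eq_le intro: Max_ge)+
  show thesis
  proof (rule that[of N])
    show "a (monom 1 k) = 0" if "k \<ge> N" for k
      unfolding a using that N by (intro sum.neutral) (fastforce simp: E_op_def)
    show "coeff (a p) k = 0" if "k \<ge> N" for k p
      unfolding a coeff_sum using that N by (intro sum.neutral) (fastforce simp: E_op_def)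
  qed
qed

text \<open>The coefficient of \<open>x^i\<close> in \<open>b (x^k)\<close> is
  \<open>fact k / fact i\<close> times that of \<open>x^k\<close> in \<open>a (x^i)\<close>, so the
  row bound for \<open>a\<close> makes the far columns of \<open>b\<close> vanish.\<close>

lemma adj_F_ideal:
  assumes ab: "adj a b" and lin: "Vector_Spaces.linear smult smult b" and "a \<in> F_ideal"
  shows "b \<in> F_ideal"
proof -
  obtain N where N: "\<And>k p. k \<ge> N \<Longrightarrow> coeff (a p) k = 0"
    using F_idealE[OF \<open>a \<in> F_ideal\<close>] by metis
  have "b (monom 1 k) = 0" if "k \<ge> N" for k
  proof (rule poly_eqI)
    fix i
    have "fact i * coeff (b (monom 1 k)) i = fischer (a (monom 1 i)) (monom 1 k)"
      using ab by (simp add: adj_def fischer_monom)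
    also have "\<dots> = 0"
      using N[OF that] by (subst fischer_sym) (simp add: fischer_monom)
    finally show "coeff (b (monom 1 k)) i = coeff 0 i" by simp
  qed
  then show ?thesis using F_idealI[OF lin] by blast
qed

lemma F_ideal_not_inj:
  assumes "a \<in> F_ideal"
  shows "\<not> inj a"
proof -
  obtain N where N: "\<And>k. k \<ge> N \<Longrightarrow> a (monom 1 k) = 0"
    using F_idealE[OF assms] by metis
  have "a (monom 1 N) = a (monom 1 (Suc N))" by (simp add: N)
  moreover have "monom (1::'a) N \<noteq> monom 1 (Suc N)" by (simp add: monom_eq_iff')
  ultimately show ?thesis by (meson injD)
qed

section \<open>Injectivity on the multiples of a power of \<open>x\<close>\<close>

lemma X_op_funpow: "(X_op ^^ i) p = monom 1 i * p"
  by (induction i) (simp_all add: X_op_def monom_Suc)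

lemma linear_injI:
  fixes f :: "('k::field_char_0) poly_map"
  assumes lin: "Vector_Spaces.linear smult smult f" and "\<And>p. f p = 0 \<Longrightarrow> p = 0"
  shows "inj f"
proof (rule injI)
  fix p q assume "f p = f q"
  then have "f (p + smult (-1) q) = 0" using lin unfolding linear_smult_iff by (simp only:) simp
  from assms(2)[OF this] show "p = q" by simp
qed

text \<open>If every diagonal is eventually zero, \<open>b\<close> kills all large monomials.
  Otherwise the highest surviving diagonal \<open>j\<close> gives \<open>b (x^k)\<close> degree
  exactly \<open>k - n + j\<close> for large \<open>k\<close>. Distinct monomials then have images
  of distinct degrees, and leading terms cannot cancel.\<close>

lemma F_ideal_or_inj:
  fixes b :: "('k::field_char_0) poly_map"
  assumes carrier: "b \<in> carrier jacobian_algebra"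
  shows "b \<in> F_ideal \<or> (\<exists>N. inj (b \<circ> X_op ^^ N))"
proof -
  note lin = jacobian_linear[OF carrier]
  obtain n m \<Phi> where deg: "\<And>k. degree (\<Phi> k) \<le> m"
    and rat: "\<And>j. eventually_rational (\<lambda>k. coeff (\<Phi> k) j)"
    and band: "\<forall>\<^sub>F k in sequentially. b (monom 1 k) = monom 1 (k - n) * \<Phi> k"
    using jacobian_rational_band[OF carrier] unfolding rational_band_def by blast
  \<comment> \<open>The diagonals that survive; by the dichotomy they are eventually nonzero
    everywhere.\<close>
  define J where "J = {j. j \<le> m \<and> \<not> (\<forall>\<^sub>F k in sequentially. coeff (\<Phi> k) j = 0)}"
  have "\<forall>\<^sub>F k in sequentially. coeff (\<Phi> k) j = 0" if "j \<notin> J" for j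
  proof (cases "j \<le> m")
    case False
    then have "coeff (\<Phi> k) j = 0" for k
      using deg[of k] by (simp add: coeff_eq_0)
    then show ?thesis by simp
  qed (use that in \<open>simp add: J_def\<close>)
  \<comment> \<open>A common threshold exists because only the finitely many
    \<open>j \<le> m\<close> matter; above \<open>m\<close> the degree bound makes the coefficients
    zero for all \<open>k\<close>.\<close>
  then have "\<forall>\<^sub>F k in sequentially. \<forall>j\<in>{..m} - J. coeff (\<Phi> k) j = 0"
    by (intro eventually_ball_finite) auto
  then have out: "\<forall>\<^sub>F k in sequentially. \<forall>j. j \<notin> J \<longrightarrow> coeff (\<Phi> k) j = 0"
    by eventually_elim (metis DiffI atMost_iff coeff_eq_0 deg le_less_trans not_le)
  show ?thesis
  proof (cases "J = {}")
    case True
    have "\<forall>\<^sub>F k in sequentially. b (monom 1 k) = 0"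
      using band out
    proof eventually_elim
      case (elim k)
      then have "\<Phi> k = 0" by (simp add: True poly_eqI)
      with elim show ?case by simp
    qed
    then show ?thesis
      using F_idealI[OF lin] unfolding eventually_sequentially by blast
  next
    case False
    define j where "j = Max J"
    have "finite J" by (simp add: J_def)
    then have "j \<in> J" and top: "\<And>i. i \<in> J \<Longrightarrow> i \<le> j" using False by (auto simp: j_def)
    then have "\<forall>\<^sub>F k in sequentially. coeff (\<Phi> k) j \<noteq> 0"
      using eventually_rational_dichotomy[OF rat, of j] by (auto simp: J_def)
    with band out have "\<forall>\<^sub>F k in sequentially. k \<ge> n \<and> b (monom 1 k) = monom 1 (k - n) * \<Phi> k \<and>
        (\<forall>i>j. coeff (\<Phi> k) i = 0) \<and> coeff (\<Phi> k) j \<noteq> 0"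
      using eventually_ge_at_top[of n] by eventually_elim (use top leD in blast)
    then obtain N where N: "\<And>k. k \<ge> N \<Longrightarrow> k \<ge> n"
      "\<And>k. k \<ge> N \<Longrightarrow> b (monom 1 k) = monom 1 (k - n) * \<Phi> k"
      "\<And>k i. k \<ge> N \<Longrightarrow> i > j \<Longrightarrow> coeff (\<Phi> k) i = 0"
      "\<And>k. k \<ge> N \<Longrightarrow> coeff (\<Phi> k) j \<noteq> 0"
      unfolding eventually_sequentially by metis
    have "inj (b \<circ> X_op ^^ N)"
    proof (rule linear_injI)
      show "Vector_Spaces.linear smult smult (b \<circ> X_op ^^ N)"
        using lin by (simp add: linear_smult_iff X_op_funpow distrib_left)
      fix p assume bp: "(b \<circ> X_op ^^ N) p = 0"
      show "p = 0"
      proof (rule ccontr)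
        assume "p \<noteq> 0"
        \<comment> \<open>All monomials of \<open>q\<close> have exponent at least \<open>N\<close>,
          where the band formula holds.\<close>
        define q d where "q = monom 1 N * p" and "d = degree q"
        have q: "q \<noteq> 0" "d \<ge> N" "\<And>k. k < N \<Longrightarrow> coeff q k = 0"
          using \<open>p \<noteq> 0\<close>
          by (auto simp: q_def d_def coeff_monom_mult degree_mult_eq degree_monom_eq)
        have "b q = (\<Sum>k\<le>d. smult (coeff q k) (b (monom 1 k)))"
          by (intro linear_expansion lin) (simp add: d_def)
        then have "coeff (b q) (d - n + j) = (\<Sum>k\<le>d. coeff q k * coeff (b (monom 1 k)) (d - n + j))"
          by (simp add: coeff_sum)
        \<comment> \<open>Only the leading monomial of \<open>q\<close> reaches this coefficient:
          for \<open>N \<le> k < d\<close> the image of \<open>x^k\<close> has degree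
          \<open>k - n + j\<close>, which is smaller since \<open>n \<le> k\<close>.\<close>
        also have "\<dots> = (\<Sum>k\<in>{d}. coeff q k * coeff (b (monom 1 k)) (d - n + j))"
        proof (rule sum.mono_neutral_right)
          show "\<forall>k\<in>{..d} - {d}. coeff q k * coeff (b (monom 1 k)) (d - n + j) = 0"
          proof
            fix k assume "k \<in> {..d} - {d}"
            then have "k < d" by auto
            show "coeff q k * coeff (b (monom 1 k)) (d - n + j) = 0"
            proof (cases "k < N")
              case False
              then have "d - n + j - (k - n) > j"
                using \<open>k < d\<close> N(1)[of k] by linarith
              then show ?thesis
                using False N(2)[of k] N(3)[of k] by (simp add: coeff_monom_mult)
            qed (simp add: q)
          qed
        qed auto
        also have "\<dots> \<noteq> 0"
          using q N(2,4)[of d] by (simp add: coeff_monom_mult d_def)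
        finally show False using bp by (simp add: q_def X_op_funpow)
      qed
    qed
    then show ?thesis by blast
  qed
qed

subsection \<open>Regular elements\<close>

lemma rank_one_in_jacobian:
  fixes v :: "('k::field_char_0) poly"
  shows "(\<lambda>p. smult (coeff p 0) v) \<in> carrier jacobian_algebra"
proof -
  text \<open>The projection \<open>p \<mapsto> p(0)\<close> is \<open>1 - x H\<^sup>-\<^sup>1 \<partial>\<close>.\<close>
  have "(\<lambda>p. id p + smult (-1) ((X_op \<circ> (H_inv \<circ> D_op)) p)) \<in>
      carrier (jacobian_algebra :: 'k poly_map ring)"
    by (intro jacobian_closed)
  also have "(\<lambda>p. id p + smult (-1) ((X_op \<circ> (H_inv \<circ> D_op)) p)) = (\<lambda>p :: 'k poly. [:coeff p 0:])"
    by (auto simp: fun_eq_iff poly_eq_iff coeff_X_op coeff_H_inv coeff_D_op coeff_pCons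
        simp del: of_nat_Suc split: nat.splits)
  finally have E: "(\<lambda>p :: 'k poly. [:coeff p 0:]) \<in> carrier jacobian_algebra" .
  \<comment> \<open>Multiplication by \<open>v\<close> is built from scalars and \<open>X_op\<close>
    by Horner's scheme.\<close>
  have "(\<lambda>p. v * p) \<in> carrier jacobian_algebra"
  proof (induction v)
    case 0
    have "smult 0 = (\<lambda>p :: 'k poly. 0 * p)" by (simp add: fun_eq_iff)
    then show ?case using jacobian_closed(1)[of "0::'k"] by (simp only:)
  next
    case (pCons c v)
    have "(\<lambda>p. smult c p + (X_op \<circ> (\<lambda>p. v * p)) p) \<in> carrier jacobian_algebra"
      by (intro jacobian_closed pCons)
    then show ?case by (simp add: X_op_def)
  qed
  from jacobian_closed(6)[OF this E] show ?thesis by (simp add: comp_def)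
qed

lemma right_regular_iff_inj:
  fixes c :: "('k::field_char_0) poly_map"
  assumes carrier: "c \<in> carrier jacobian_algebra"
  shows "c \<in> right_regular jacobian_algebra \<longleftrightarrow> inj c"
proof -
  have c: "c (smult t p) = smult t (c p)" "c 0 = 0" for t p
    using jacobian_linear[OF carrier] unfolding linear_smult_iff by (auto, metis smult_0_left)
  show ?thesis
  proof
    assume reg: "c \<in> right_regular jacobian_algebra"
    show "inj c"
    proof (rule linear_injI[OF jacobian_linear[OF carrier]])
      fix v assume "c v = 0"
      \<comment> \<open>A kernel vector \<open>v\<close> yields a right annihilator of
        \<open>c\<close> inside the algebra; evaluating that annihilator at \<open>1\<close>
        recovers \<open>v\<close>.\<close>
      then have "c \<circ> (\<lambda>p. smult (coeff p 0) v) = (\<lambda>p. 0)" by (simp add: c fun_eq_iff)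
      then have "(\<lambda>p. smult (coeff p 0) v) = (\<lambda>p. 0)"
        using reg rank_one_in_jacobian[of v] by (auto simp: right_regular_def)
      from fun_cong[OF this, of 1] show "v = 0" by simp
    qed
  next
    assume "inj c"
    then have "r = (\<lambda>p. 0)" if "c \<circ> r = (\<lambda>p. 0)" for r :: "'k poly_map"
      using that c(2) by (metis comp_apply ext injD)
    then show "c \<in> right_regular jacobian_algebra"
      using carrier by (simp add: right_regular_def)
  qed
qed

section \<open>Left regularity through adjoints\<close>

lemma adj_zero: "adj (\<lambda>p. 0) b \<Longrightarrow> b = (\<lambda>p. 0)"
  by (rule adj_unique[of "\<lambda>p. 0"]) (auto simp: adj_def fischer_def)

text \<open>Adjoints reverse products and send zero to zero, so left annihilators of
  \<open>c\<close> correspond to right annihilators of \<open>b\<close>. By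
  \<open>adj_exists\<close> the correspondence stays inside the algebra, over which regularity
  quantifies.\<close>

lemma adj_left_regular_iff:
  fixes b c :: "('k::field_char_0) poly_map"
  assumes cb: "adj c b"
    and carrier: "c \<in> carrier jacobian_algebra" "b \<in> carrier jacobian_algebra"
  shows "c \<in> left_regular jacobian_algebra \<longleftrightarrow> b \<in> right_regular jacobian_algebra"
proof
  assume reg: "c \<in> left_regular jacobian_algebra"
  have "r = (\<lambda>p. 0)" if r: "r \<in> carrier jacobian_algebra" "b \<circ> r = (\<lambda>p. 0)" for r
  proof -
    obtain r' where r': "r' \<in> carrier jacobian_algebra" "adj r r'"
      using adj_exists[OF r(1)] by blast
    have "r' \<circ> c = (\<lambda>p. 0)"
      using adj_rules(7)[OF adj_sym[OF cb] r'(2)] r(2) adj_zero by metis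
    then have "r' = (\<lambda>p. 0)" using reg r' by (auto simp: left_regular_def)
    then show ?thesis using adj_sym[OF r'(2)] adj_zero by blast
  qed
  then show "b \<in> right_regular jacobian_algebra" using carrier by (simp add: right_regular_def)
next
  assume reg: "b \<in> right_regular jacobian_algebra"
  have "r = (\<lambda>p. 0)" if r: "r \<in> carrier jacobian_algebra" "r \<circ> c = (\<lambda>p. 0)" for r
  proof -
    obtain r' where r': "r' \<in> carrier jacobian_algebra" "adj r r'"
      using adj_exists[OF r(1)] by blast
    have "b \<circ> r' = (\<lambda>p. 0)"
      using adj_rules(7)[OF r'(2) cb] r(2) adj_zero by metis
    then have "r' = (\<lambda>p. 0)" using reg r' by (auto simp: right_regular_def)
    then show ?thesis using adj_sym[OF r'(2)] adj_zero by blast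
  qed
  then show "c \<in> left_regular jacobian_algebra" using carrier by (simp add: left_regular_def)
qed

lemma left_regular_iff_inj:
  assumes "adj c b" "c \<in> carrier jacobian_algebra" "b \<in> carrier jacobian_algebra"
  shows "c \<in> left_regular jacobian_algebra \<longleftrightarrow> inj b"
  using adj_left_regular_iff[OF assms] right_regular_iff_inj[OF assms(3)] by simp

text \<open>The adjoint of an element of \<open>F\<close> lies again in \<open>F\<close>, hence is
  not injective.\<close>

lemma left_regular_not_in_F:
  assumes "c \<in> left_regular jacobian_algebra"
  shows "c \<notin> F_ideal"
proof
  assume "c \<in> F_ideal"
  have c: "c \<in> carrier jacobian_algebra" using assms by (simp add: left_regular_def)
  obtain b where b: "b \<in> carrier jacobian_algebra" "adj c b" using adj_exists[OF c] by blast
  have "b \<in> F_ideal" using adj_F_ideal[OF b(2) jacobian_linear[OF b(1)] \<open>c \<in> F_ideal\<close>] .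
  moreover have "inj b" using left_regular_iff_inj[OF b(2) c b(1)] assms by simp
  ultimately show False using F_ideal_not_inj by blast
qed

section \<open>Left regularity after multiplication by a power of \<open>\<partial>\<close>\<close>

lemma funpow_in_jacobian:
  "a \<in> carrier jacobian_algebra \<Longrightarrow> a ^^ i \<in> carrier jacobian_algebra"
proof (induction i)
  case 0
  show ?case unfolding funpow.simps by (rule jacobian_closed(5))
next
  case (Suc i)
  then show ?case unfolding funpow.simps by (intro jacobian_closed(6))
qed

lemma jacobian_nat_pow: "a [^]\<^bsub>jacobian_algebra\<^esub> (i::nat) = a ^^ i"
  by (induction i) (simp_all add: Group.nat_pow_def funpow_swap1 comp_def fun_eq_iff)

lemma adj_D_funpow: "adj (D_op ^^ i) (X_op ^^ i)"
proof (induction i)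
  case (Suc i)
  from adj_rules(7)[OF adj_rules(3) Suc] show ?case by (metis funpow.simps(2) funpow_Suc_right)
qed (use adj_rules(5) in \<open>simp add: id_def\<close>)

text \<open>This ensures that the \<open>LEAST\<close> in \<open>d_index\<close> ranges over a
  nonempty set.\<close>

lemma ex_D_pow_left_regular:
  fixes a :: "('k::field_char_0) poly_map"
  assumes a: "a \<in> carrier jacobian_algebra - F_ideal"
  shows "\<exists>i::nat. D_op [^]\<^bsub>jacobian_algebra\<^esub> i \<otimes>\<^bsub>jacobian_algebra\<^esub> a \<in> left_regular jacobian_algebra"
proof -
  obtain b where b: "b \<in> carrier jacobian_algebra" "adj a b" using adj_exists[of a] a by blast
  have "b \<notin> F_ideal"
    using adj_F_ideal[OF adj_sym[OF b(2)]] jacobian_linear a by blast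
  then obtain N where N: "inj (b \<circ> X_op ^^ N)" using F_ideal_or_inj[OF b(1)] by blast
  have "adj (D_op ^^ N \<circ> a) (b \<circ> X_op ^^ N)" by (rule adj_rules(7)[OF adj_D_funpow b(2)])
  from left_regular_iff_inj[OF this] N show ?thesis
    using a b by (auto simp: jacobian_nat_pow intro!: exI[of _ N] jacobian_closed funpow_in_jacobian)
qed

text \<open>\<open>involution\<close> is given only by a description. Its values on the generators
  and its anti-multiplicativity match those of the Fischer adjoint, so induction over the algebra
  identifies the two.\<close>

lemma involution_adj:
  fixes a :: "('k::field_char_0) poly_map"
  assumes "a \<in> carrier jacobian_algebra"
  shows "adj a (involution a)"
proof -
  note inv = is_involution_involution[where 'k = 'k, unfolded is_involution_def Let_def jacobian_simps]
  have one: "involution id = (id :: 'k poly_map)"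
    and scale: "involution (\<lambda>p. smult c (a p)) = (\<lambda>p. smult c (involution a p))"
    and plus: "involution (\<lambda>p. a p + b p) = (\<lambda>p. involution a p + involution b p)"
    and times: "involution (a \<circ> b) = involution b \<circ> involution a"
    and gens: "involution X_op = (D_op :: 'k poly_map)" "involution D_op = (X_op :: 'k poly_map)"
      "involution H_inv = (H_inv :: 'k poly_map)"
    if "a \<in> carrier jacobian_algebra" "b \<in> carrier jacobian_algebra" for a b :: "'k poly_map" and c
    using inv that by blast+
  from assms show ?thesis
  proof (induction a rule: jacobian_induct)
    case (smult c)
    \<comment> \<open>A scalar operator is a multiple of the identity, so linearity and unitality
      fix its image.\<close>
    have "involution (\<lambda>p. smult c (id p)) = (\<lambda>p. smult c (involution id p))"
      by (rule scale) (rule jacobian_closed)+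
    then have "involution (smult c) = smult c"
      by (simp add: one[OF jacobian_closed(5,5)])
    then show ?case using adj_rules(1)[of c] by (simp only:)
  next
    case X
    show ?case unfolding gens[OF jacobian_closed(5,5)] by (rule adj_rules)
  next
    case D
    show ?case unfolding gens[OF jacobian_closed(5,5)] by (rule adj_rules)
  next
    case Hinv
    show ?case unfolding gens[OF jacobian_closed(5,5)] by (rule adj_rules)
  next
    case (add a b)
    then show ?case unfolding plus[OF add.hyps] by (intro adj_rules)
  next
    case (comp a b)
    then show ?case unfolding times[OF comp.hyps] by (intro adj_rules)
  qed
qed

lemma bij_betw_involution:
  "bij_betw involution (carrier jacobian_algebra)
     (carrier (jacobian_algebra :: ('k::field_char_0) poly_map ring))"
  using is_involution_involution[where 'k = 'k] by (simp add: is_involution_def Let_def)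

text \<open>Since \<open>involution c\<close> is the adjoint of \<open>c\<close>, regularity
  transfers in both directions; surjectivity on the algebra supplies the preimage of a given right
  regular element.\<close>

lemma right_regular_eq_involution_image:
  "right_regular (jacobian_algebra :: ('k::field_char_0) poly_map ring) =
     involution ` left_regular jacobian_algebra"
proof -
  have iff: "c \<in> left_regular jacobian_algebra \<longleftrightarrow> involution c \<in> right_regular jacobian_algebra"
    if "c \<in> carrier jacobian_algebra" for c :: "'k poly_map"
    using that bij_betwE[OF bij_betw_involution] involution_adj adj_left_regular_iff by blast
  have surj: "carrier jacobian_algebra = involution ` carrier (jacobian_algebra :: 'k poly_map ring)"
    using bij_betw_imp_surj_on[OF bij_betw_involution] by (rule sym)
  show ?thesis
  proof (intro subset_antisym subsetI)
    fix b :: "'k poly_map" assume b: "b \<in> right_regular jacobian_algebra"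
    then have "b \<in> involution ` carrier jacobian_algebra"
      by (subst surj[symmetric]) (simp add: right_regular_def)
    then obtain c where "c \<in> carrier jacobian_algebra" "b = involution c" by (rule imageE)
    with b iff show "b \<in> involution ` left_regular jacobian_algebra" by simp
  next
    fix b :: "'k poly_map" assume "b \<in> involution ` left_regular jacobian_algebra"
    then obtain c where c: "c \<in> left_regular jacobian_algebra" "b = involution c" by (rule imageE)
    then have "c \<in> carrier jacobian_algebra" by (simp add: left_regular_def)
    with c iff show "b \<in> right_regular jacobian_algebra" by simp
  qed
qed

theorem theorem5p7:
  shows "left_regular (jacobian_algebra :: ('k::field_char_0) poly_map ring) =
           {D_op [^]\<^bsub>jacobian_algebra\<^esub> d_index a \<otimes>\<^bsub>jacobian_algebra\<^esub> a | a.
              a \<in> carrier jacobian_algebra - F_ideal} \<and>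
         right_regular (jacobian_algebra :: 'k poly_map ring) =
           involution ` left_regular jacobian_algebra"
proof (intro conjI subset_antisym subsetI)
  fix c :: "'k poly_map" assume c: "c \<in> left_regular jacobian_algebra"
  \<comment> \<open>A left regular \<open>c\<close> serves as its own witness: the exponent
    \<open>0\<close> already works, so \<open>d_index c = 0\<close>.\<close>
  have "D_op [^]\<^bsub>jacobian_algebra\<^esub> (0::nat) \<otimes>\<^bsub>jacobian_algebra\<^esub> c = c"
    by (simp add: jacobian_nat_pow fun_eq_iff)
  moreover from this have "d_index c = 0"
    unfolding d_index_def using c by (intro Least_eq_0) simp
  moreover have "c \<in> carrier jacobian_algebra - F_ideal"
    using c left_regular_not_in_F by (auto simp: left_regular_def)
  ultimately show "c \<in> {D_op [^]\<^bsub>jacobian_algebra\<^esub> d_index a \<otimes>\<^bsub>jacobian_algebra\<^esub> a | a.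
              a \<in> carrier jacobian_algebra - F_ideal}"
    by (intro CollectI exI[of _ c]) simp
next
  fix c :: "'k poly_map"
  assume "c \<in> {D_op [^]\<^bsub>jacobian_algebra\<^esub> d_index a \<otimes>\<^bsub>jacobian_algebra\<^esub> a | a.
              a \<in> carrier jacobian_algebra - F_ideal}"
  then show "c \<in> left_regular jacobian_algebra"
    using LeastI_ex[OF ex_D_pow_left_regular] by (auto simp: d_index_def)
qed (simp_all add: right_regular_eq_involution_image)

end
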